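(* Every integer matrix $M\in\mathbb Z^{m\times n}$ can be brought, using only negations of rows and of columns, to a form in which every nonzero row and every nonzero column begins with a negative entry.
   Context: A vector $v$ begins with a negative entry if its first nonzero coordinate is negative. *)

theory Defs
  imports "Jordan_Normal_Form.Column_Operations"
begin

definition begins_with_negative :: "int vec \<Rightarrow> bool" where
  "begins_with_negative v \<longleftrightarrow>
     (\<exists>k < dim_vec v. v $ k < 0 \<and> (\<forall>l < k. v $ l = 0))"

inductive negation_step :: "int mat \<Rightarrow> int mat \<Rightarrow> bool" where
  negate_row: "i < dim_row A \<Longrightarrow> negation_step A (multrow i (- 1) A)"
| negate_col: "j < dim_col A \<Longrightarrow> negation_step A (multcol j (- 1) A)"

end

theory Submission
  imports Defs
begin

text \<open>
  Give the entry at position \<open>(i, j)\<close> of an \<open>m \<times> n\<close> matrix the weight \<open>2 ^ (m - i) * 2 ^ (n - j)\<close>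
  and let the potential of a matrix be the total weight of its positive entries. Within a row or
  a column the weight of any entry exceeds the sum of the weights of all later entries, so
  negating a row or column that begins with a positive entry strictly decreases the potential.
  Hence a matrix of minimal potential among those reachable from the given one has the required
  form.
\<close>

definition vec_potential :: "int vec \<Rightarrow> nat" where
  "vec_potential v = (\<Sum>j<dim_vec v. if v $ j > 0 then 2 ^ (dim_vec v - j) else 0)"

text \<open>The row factor is constant along each row, so rows are compared by
  \<open>vec_potential\<close> alone; it makes the weight of an entry a product, symmetric in rows
  and columns.\<close>

definition mat_potential :: "int mat \<Rightarrow> nat" where
  "mat_potential A = (\<Sum>i<dim_row A. 2 ^ (dim_row A - i) * vec_potential (row A i))"

lemma begins_with_negative_uminus:
  assumes "v \<noteq> 0\<^sub>v (dim_vec v)" and "\<not> begins_with_negative v"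
  shows "begins_with_negative (- v)"
proof -
  define P where "P k \<longleftrightarrow> k < dim_vec v \<and> v $ k \<noteq> 0" for k
  have "\<exists>k. P k"
    using assms(1) unfolding P_def by (metis eq_vecI index_zero_vec)
  then obtain k where k: "P k" "\<And>l. l < k \<Longrightarrow> \<not> P l"
    by (meson exists_least_iff)
  then have zero: "v $ l = 0" if "l < k" for l
    using that unfolding P_def by auto
  with k assms(2) have "v $ k > 0"
    unfolding begins_with_negative_def P_def by (metis linorder_neqE_linordered_idom)
  with k zero show ?thesis
    unfolding begins_with_negative_def P_def by (intro exI[of _ k]) auto
qed

text \<open>A geometric sum whose smallest term is 2, the weight of the last index. The additive
  form avoids truncated subtraction on \<open>nat\<close>.\<close>

lemma sum_power2_diff:
  fixes k n :: nat
  assumes "k \<le> n"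
  shows "(\<Sum>j=k..<n. 2 ^ (n - j)) + 2 = (2 * 2 ^ (n - k) :: nat)"
  using assms
proof (induction k rule: inc_induct)
  case (step k)
  then have "n - k = Suc (n - Suc k)" by simp
  with step show ?case
    by (simp add: sum.atLeast_Suc_lessThan)
qed simp

text \<open>The hypothesis says that \<open>v\<close> begins with a positive entry, at
  \<open>k\<close> say. Negation loses its weight and can gain at most the weights after
  \<open>k\<close>.\<close>

lemma vec_potential_uminus_less:
  assumes "begins_with_negative (- v)"
  shows "vec_potential (- v) < vec_potential v"
proof -
  let ?n = "dim_vec v"
  obtain k where k: "k < ?n" "v $ k > 0" and zero: "\<And>l. l < k \<Longrightarrow> v $ l = 0"
    using assms unfolding begins_with_negative_def by force
  have "vec_potential (- v) = (\<Sum>j<?n. if v $ j < 0 then 2 ^ (?n - j) else 0)"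
    unfolding vec_potential_def by (intro sum.cong) auto
  \<comment> \<open>No index up to \<open>k\<close> contributes: the entries before \<open>k\<close>
    vanish and the one at \<open>k\<close> is positive.\<close>
  also have "\<dots> = (\<Sum>j=Suc k..<?n. if v $ j < 0 then 2 ^ (?n - j) else 0)"
  proof (intro sum.mono_neutral_right ballI)
    fix j assume "j \<in> {..<?n} - {Suc k..<?n}"
    then have "j < k \<or> j = k" by auto
    then show "(if v $ j < 0 then 2 ^ (?n - j) else 0) = (0 :: nat)"
      using k zero by auto
  qed auto
  also have "\<dots> \<le> (\<Sum>j=Suc k..<?n. 2 ^ (?n - j))"
    by (intro sum_mono) auto
  also have "\<dots> < 2 ^ (?n - k)"
    using sum_power2_diff[of "Suc k" ?n] k by (simp add: Suc_diff_Suc flip: power_Suc)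
  also have "\<dots> \<le> vec_potential v"
    unfolding vec_potential_def
    using member_le_sum[of k "{..<?n}" "\<lambda>j. if v $ j > 0 then 2 ^ (?n - j) else 0 :: nat"] k
    by simp
  finally show ?thesis .
qed

text \<open>Swapping the two sums suffices, as the weight of an entry is a product; this reduces
  columns to rows.\<close>

lemma mat_potential_transpose: "mat_potential (transpose_mat A) = mat_potential A"
proof -
  let ?m = "dim_row A" and ?n = "dim_col A"
  let ?w = "\<lambda>i j. if A $$ (i, j) > 0 then 2 ^ (?m - i) * 2 ^ (?n - j) else 0 :: nat"
  have "mat_potential A = (\<Sum>i<?m. \<Sum>j<?n. ?w i j)"
    unfolding mat_potential_def vec_potential_def sum_distrib_left
    by (intro sum.cong) auto
  also have "\<dots> = (\<Sum>j<?n. \<Sum>i<?m. ?w i j)"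
    by (rule sum.swap)
  also have "\<dots> = mat_potential (transpose_mat A)"
    unfolding mat_potential_def vec_potential_def sum_distrib_left
    by (intro sum.cong) auto
  finally show ?thesis ..
qed

lemma mat_potential_negate_row_less:
  assumes i: "i < dim_row A" and "begins_with_negative (- row A i)"
  shows "mat_potential (multrow i (- 1) A) < mat_potential A"
proof -
  have same: "row (multrow i (- 1) A) i = - row A i"
    using i by (intro eq_vecI) auto
  have other: "row (multrow i (- 1) A) l = row A l" if "l < dim_row A" "l \<noteq> i" for l
    using that by (intro eq_vecI) auto
  have less: "vec_potential (- row A i) < vec_potential (row A i)"
    using assms(2) by (rule vec_potential_uminus_less)
  have "vec_potential (row (multrow i (- 1) A) l) \<le> vec_potential (row A l)"
    if "l < dim_row A" for l
    using that less by (cases "l = i") (simp_all add: same other)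
  moreover have "vec_potential (row (multrow i (- 1) A) i) < vec_potential (row A i)"
    using less by (simp add: same)
  ultimately show ?thesis
    \<comment> \<open>Only the summand of row \<open>i\<close> changes, and its factor is a positive
      power of 2, so the strict decrease survives.\<close>
    unfolding mat_potential_def index_mat_multrow using i
    by (intro sum_strict_mono_ex1) auto
qed

lemma mat_potential_negate_col_less:
  assumes j: "j < dim_col A" and "begins_with_negative (- col A j)"
  shows "mat_potential (multcol j (- 1) A) < mat_potential A"
proof -
  have "transpose_mat (multcol j (- 1) A) = multrow j (- 1) (transpose_mat A)"
    by (intro eq_matI) auto
  then show ?thesis
    using mat_potential_negate_row_less[of j "transpose_mat A"] assms
    by (metis index_transpose_mat(2) mat_potential_transpose row_transpose)
qed

lemma negation_steps_carrier_mat: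
  assumes "negation_step\<^sup>*\<^sup>* A B" and "A \<in> carrier_mat m n"
  shows "B \<in> carrier_mat m n"
  using assms by (induction rule: rtranclp_induct) (auto elim!: negation_step.cases)

theorem theorem3p3:
  fixes M :: "int mat" and m n :: nat
  assumes "M \<in> carrier_mat m n"
  shows "\<exists>N \<in> carrier_mat m n. negation_step\<^sup>*\<^sup>* M N \<and>
    (\<forall>i < m. row N i \<noteq> 0\<^sub>v n \<longrightarrow> begins_with_negative (row N i)) \<and>
    (\<forall>j < n. col N j \<noteq> 0\<^sub>v m \<longrightarrow> begins_with_negative (col N j))"
proof -
  \<comment> \<open>\<open>M\<close> reaches itself, so the set of reachable matrices is nonempty
    and a least potential exists.\<close>
  obtain N where N: "negation_step\<^sup>*\<^sup>* M N"
    and minimal: "\<And>A. negation_step\<^sup>*\<^sup>* M A \<Longrightarrow> mat_potential N \<le> mat_potential A"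
    using ex_has_least_nat[of "negation_step\<^sup>*\<^sup>* M" M mat_potential] by auto
  have carrier: "N \<in> carrier_mat m n"
    using N assms by (rule negation_steps_carrier_mat)
  then have dims: "dim_row N = m" "dim_col N = n" by auto
  have step: "\<not> mat_potential A < mat_potential N" if "negation_step N A" for A
    using minimal[of A] N that by (simp add: rtranclp.rtrancl_into_rtrancl leD)
  \<comment> \<open>Otherwise the negated row would begin with a negative entry, and negating it in
    \<open>N\<close> would contradict minimality.\<close>
  have "begins_with_negative (row N i)" if "i < m" "row N i \<noteq> 0\<^sub>v n" for i
    using that begins_with_negative_uminus[of "row N i"] mat_potential_negate_row_less[of i N]
      step[OF negate_row[of i N]] by (auto simp: dims)
  moreover have "begins_with_negative (col N j)" if "j < n" "col N j \<noteq> 0\<^sub>v m" for j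
    using that begins_with_negative_uminus[of "col N j"] mat_potential_negate_col_less[of j N]
      step[OF negate_col[of j N]] by (auto simp: dims)
  ultimately show ?thesis
    using carrier N by blast
qed

end
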